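(* Let $n\ge 2$. There is an orientation-reversing rotationally symmetric harmonic diffeomorphism from $\mathbb{H}_*^n$ onto $\mathbb{R}_*^n$. Moreover, it is unique up to a combination of dilation and rotation of $\mathbb{R}^n$: if $u_1,u_2:\mathbb{H}_*^n\to\mathbb{R}_*^n$ are two such maps, then there exist $\lambda>0$ and a rotation $A\in SO(n)$ of $\mathbb{R}^n$ such that $u_2=\lambda A\circ u_1$.
   Context: In polar coordinates, with $(\mathbb{S}^{n-1},d\theta^2)$ the standard unit $(n-1)$-sphere, write $\mathbb{R}^n=(\mathbb{S}^{n-1}\times[0,\infty),\ r^2d\theta^2+dr^2)$ for Euclidean space and $\mathbb{H}^n=(\mathbb{S}^{n-1}\times[0,\infty),\ \sinh^2 r\,d\theta^2+dr^2)$ for hyperbolic space (in both cases $r=0$ is collapsed to the origin $0$). Set $\mathbb{R}_*^n=\mathbb{R}^n\setminus\{0\}$ and $\mathbb{H}_*^n=\mathbb{H}^n\setminus\{0\}$, so that both are $\mathbb{S}^{n-1}\times(0,\infty)$ as manifolds, with the metrics above, and with the same orientation on $\mathbb{S}^{n-1}\times(0,\infty)$. A map $u:\mathbb{H}_*^n\to\mathbb{R}_*^n$ is rotationally symmetric if, up to a rotation of $\mathbb{R}^n$, it has the form $u(r,\theta)=(y(r),\theta)$, i.e. the image point has radial coordinate $y(r)>0$ and spherical coordinate $\theta$; equivalently $u(r,\theta)=(y(r),A\theta)$ for some function $y$ and some $A\in SO(n)$. Harmonic means harmonic map between Riemannian manifolds. A diffeomorphism from $\mathbb{H}_*^n$ to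 $\mathbb{R}_*^n$ is understood to be onto. *)

theory Defs
  imports "HOL-Analysis.Analysis"
begin

section \<open>Smooth maps and diffeomorphisms between open sets\<close>

text \<open>The set \<open>S\<close> is always meant to be open.\<close>

primrec Ck_on :: "nat \<Rightarrow> 'a::real_normed_vector set \<Rightarrow> ('a \<Rightarrow> 'b::real_normed_vector) \<Rightarrow> bool" where
  "Ck_on 0 S f \<longleftrightarrow> continuous_on S f"
| "Ck_on (Suc k) S f \<longleftrightarrow>
     (\<forall>x\<in>S. f differentiable (at x)) \<and> (\<forall>v. Ck_on k S (\<lambda>x. frechet_derivative f (at x) v))"

definition smooth_on :: "'a::real_normed_vector set \<Rightarrow> ('a \<Rightarrow> 'b::real_normed_vector) \<Rightarrow> bool" where
  "smooth_on S f \<longleftrightarrow> (\<forall>k. Ck_on k S f)"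

definition diffeomorphism_onto ::
    "'a::real_normed_vector set \<Rightarrow> 'b::real_normed_vector set \<Rightarrow> ('a \<Rightarrow> 'b) \<Rightarrow> bool" where
  "diffeomorphism_onto S T f \<longleftrightarrow>
     bij_betw f S T \<and> smooth_on S f \<and> smooth_on T (inv_into S f)"

definition orientation_reversing_on :: "(real^'n) set \<Rightarrow> (real^'n \<Rightarrow> real^'n) \<Rightarrow> bool" where
  "orientation_reversing_on S f \<longleftrightarrow> (\<forall>x\<in>S. det (jacobian f (at x)) < 0)"


section \<open>Harmonic maps between Riemannian metrics in global coordinates\<close>

text \<open>A Riemannian metric on an open subset of \<open>real^'n\<close> is given by its Gram matrix
  \<open>g x $ i $ j\<close> with respect to the standard coordinate vector fields.\<close>

definition pdiff :: "'n::finite \<Rightarrow> (real^'n \<Rightarrow> 'b::real_normed_vector) \<Rightarrow> real^'n \<Rightarrow> 'b" where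
  "pdiff i f x = frechet_derivative f (at x) (axis i 1)"

text \<open>\<open>christoffel g x k i j\<close> has upper index \<open>k\<close> and lower indices \<open>i\<close>, \<open>j\<close>.\<close>

definition christoffel :: "(real^'n \<Rightarrow> real^'n^'n) \<Rightarrow> real^'n \<Rightarrow> 'n \<Rightarrow> 'n \<Rightarrow> 'n \<Rightarrow> real" where
  "christoffel g x k i j =
     (1/2) * (\<Sum>l\<in>UNIV. matrix_inv (g x) $ k $ l *
        (pdiff i (\<lambda>z. g z $ j $ l) x + pdiff j (\<lambda>z. g z $ i $ l) x - pdiff l (\<lambda>z. g z $ i $ j) x))"

text \<open>The tension field, i.e. the trace of the second fundamental form of \<open>u\<close>, where \<open>g\<close> is the
  metric of the source and \<open>h\<close> the metric of the target.\<close>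

definition tension ::
    "(real^'n \<Rightarrow> real^'n^'n) \<Rightarrow> (real^'m \<Rightarrow> real^'m^'m) \<Rightarrow> (real^'n \<Rightarrow> real^'m) \<Rightarrow> real^'n \<Rightarrow> real^'m" where
  "tension g h u x = (\<chi> a. \<Sum>i\<in>UNIV. \<Sum>j\<in>UNIV. matrix_inv (g x) $ i $ j *
      (pdiff i (pdiff j (\<lambda>z. u z $ a)) x
       - (\<Sum>k\<in>UNIV. christoffel g x k i j * pdiff k (\<lambda>z. u z $ a) x)
       + (\<Sum>b\<in>UNIV. \<Sum>c\<in>UNIV. christoffel h (u x) a b c
              * pdiff i (\<lambda>z. u z $ b) x * pdiff j (\<lambda>z. u z $ c) x)))"

definition harmonic_map_on ::
    "(real^'n) set \<Rightarrow> (real^'n \<Rightarrow> real^'n^'n) \<Rightarrow> (real^'m \<Rightarrow> real^'m^'m) \<Rightarrow> (real^'n \<Rightarrow> real^'m) \<Rightarrow> bool" where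
  "harmonic_map_on S g h u \<longleftrightarrow> smooth_on S u \<and> (\<forall>x\<in>S. tension g h u x = 0)"


section \<open>Polar coordinates and the two punctured model spaces\<close>

text \<open>The manifold \<open>S\<^sup>n\<^sup>-\<^sup>1 \<times> (0,\<infinity>)\<close> is identified with the open set \<open>punctured\<close> through
  \<open>(\<theta>, r) \<mapsto> r \<theta>\<close>, so that \<open>r = norm x\<close> and \<open>\<theta> = sgn x = x / norm x\<close>. This fixes the smooth
  structure and the orientation, the same one for both metrics.\<close>

definition punctured :: "(real^'n) set" where
  "punctured = UNIV - {0}"

text \<open>The metric \<open>dr\<^sup>2 + f(r)\<^sup>2 d\<theta>\<^sup>2\<close>; the round metric \<open>d\<theta>\<^sup>2\<close> of the unit sphere is induced by the
  inner product of the ambient space.\<close>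

definition polar_metric :: "(real \<Rightarrow> real) \<Rightarrow> real^'n \<Rightarrow> real^'n^'n" where
  "polar_metric f x = (\<chi> i j. pdiff i norm x * pdiff j norm x
                        + (f (norm x))\<^sup>2 * (pdiff i sgn x \<bullet> pdiff j sgn x))"

definition flat_metric :: "real^'n \<Rightarrow> real^'n^'n" where
  "flat_metric = polar_metric (\<lambda>r. r)"

definition hyperbolic_metric :: "real^'n \<Rightarrow> real^'n^'n" where
  "hyperbolic_metric = polar_metric sinh"

lemma pdiff_norm:
  fixes x :: "real^'n"
  assumes "x \<noteq> 0"
  shows "pdiff i norm x = x $ i / norm x"
proof -
  have "frechet_derivative norm (at x) = (\<lambda>h. h \<bullet> sgn x)"
    using frechet_derivative_at[OF has_derivative_norm[OF assms]]
    by (simp add: inner_commute)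
  then show ?thesis
    by (simp add: pdiff_def sgn_div_norm inner_axis' divide_inverse mult.commute)
qed

lemma pdiff_sgn:
  fixes x :: "real^'n"
  assumes "x \<noteq> 0"
  shows "pdiff i sgn x = (1 / norm x) *\<^sub>R (axis i 1 - (x $ i / (norm x)\<^sup>2) *\<^sub>R x)"
proof -
  have n: "norm x \<noteq> 0" using assms by simp
  have "((\<lambda>z. inverse (norm z) *\<^sub>R z) has_derivative
      (\<lambda>h. inverse (norm x) *\<^sub>R h + (- (inverse (norm x) * (h \<bullet> sgn x) * inverse (norm x))) *\<^sub>R x)) (at x)"
    using assms by (auto intro!: derivative_eq_intros has_derivative_norm simp: n inner_commute)
  moreover have "(\<lambda>z. inverse (norm z) *\<^sub>R z) = (sgn :: real^'n \<Rightarrow> _)"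
    by (simp add: sgn_div_norm fun_eq_iff)
  ultimately have "(sgn has_derivative
      (\<lambda>h. inverse (norm x) *\<^sub>R h + (- (inverse (norm x) * (h \<bullet> sgn x) * inverse (norm x))) *\<^sub>R x)) (at x)"
    by simp
  from frechet_derivative_at[OF this, symmetric]
  show ?thesis
    by (simp add: pdiff_def sgn_div_norm inner_axis' algebra_simps divide_inverse power2_eq_square)
qed

lemma polar_metric_explicit:
  fixes x :: "real^'n"
  assumes "x \<noteq> 0"
  shows "polar_metric f x $ i $ j =
    x $ i * x $ j / (norm x)\<^sup>2
    + (f (norm x) / norm x)\<^sup>2 * ((if i = j then 1 else 0) - x $ i * x $ j / (norm x)\<^sup>2)"
proof -
  have n: "norm x \<noteq> 0" and n2: "x \<bullet> x = (norm x)\<^sup>2"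
    using assms by (simp_all add: dot_square_norm)
  have "(axis i 1 - (x $ i / (norm x)\<^sup>2) *\<^sub>R x) \<bullet> (axis j 1 - (x $ j / (norm x)\<^sup>2) *\<^sub>R x)
      = (if i = j then 1 else 0) - x $ i * x $ j / (norm x)\<^sup>2"
    using n by (simp add: inner_diff_left inner_diff_right inner_axis inner_axis' n2 axis_eq_axis)
       (auto simp: axis_def)
  then show ?thesis
    using n by (simp add: polar_metric_def pdiff_norm pdiff_sgn assms power_divide power2_eq_square)
qed

lemma flat_metric_eq_mat_1: "x \<noteq> 0 \<Longrightarrow> flat_metric x = mat 1"
  by (simp add: vec_eq_iff flat_metric_def polar_metric_explicit mat_def)


section \<open>Rotationally symmetric maps\<close>

definition rotationally_symmetric :: "(real^'n \<Rightarrow> real^'n) \<Rightarrow> bool" where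
  "rotationally_symmetric u \<longleftrightarrow>
     (\<exists>(y :: real \<Rightarrow> real) A. rotation_matrix A \<and> (\<forall>r>0. y r > 0) \<and>
        (\<forall>x\<in>punctured. u x = y (norm x) *\<^sub>R (A *v sgn x)))"

definition reversing_rotsym_harmonic_diffeo :: "(real^'n \<Rightarrow> real^'n) \<Rightarrow> bool" where
  "reversing_rotsym_harmonic_diffeo u \<longleftrightarrow>
     diffeomorphism_onto punctured punctured u \<and>
     orientation_reversing_on punctured u \<and>
     rotationally_symmetric u \<and>
     harmonic_map_on punctured hyperbolic_metric flat_metric u"

end

theory Submission
  imports Defs
begin

text \<open>The target is flat, so the map \<open>y(r) A \<theta>\<close> is harmonic iff its components are harmonic on
  hyperbolic space, i.e. iff \<open>y'' + m coth(r) y' - m y / sinh(r)^2 = 0\<close> with \<open>m = n - 1\<close>. An explicit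
  solution is \<open>y = sinh(r)^(-m)\<close>: the radial harmonic function \<open>G\<close> satisfies \<open>G' = sinh^(-m)\<close>, and
  applying a translational Killing field to \<open>G\<close> gives the harmonic function \<open>G'(r) cos \<theta>\<close>.
  The Jacobian determinant is \<open>(y/r)^m y'\<close>, so orientation reversal means \<open>y' < 0\<close>, and surjectivity
  then forces \<open>y \<rightarrow> 0\<close> at infinity. If \<open>y\<close> and \<open>z\<close> are two such profiles and \<open>a > 0\<close>, then
  \<open>y(a) z - z(a) y\<close> vanishes at \<open>a\<close> and at infinity, hence on \<open>[a, \<infinity>)\<close> by the maximum principle;
  so \<open>y\<close> and \<open>z\<close> are proportional.\<close>

section \<open>Calculus of \<open>C\<^sup>k\<close> maps\<close>

text \<open>On an open set the derivative at a point depends only on nearby values, so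
  \<open>f\<close> and \<open>g\<close> have the same derivative throughout \<open>S\<close> and the
  induction passes to it.\<close>

lemma Ck_on_cong:
  assumes "open S" "\<And>x. x \<in> S \<Longrightarrow> f x = g x" "Ck_on k S f"
  shows "Ck_on k S g"
  using assms(2,3)
proof (induction k arbitrary: f g)
  case 0
  then show ?case by (simp cong: continuous_on_cong)
next
  case (Suc k)
  have g: "(g has_derivative frechet_derivative f (at x)) (at x)" if "x \<in> S" for x
  proof (rule has_derivative_transform_within_open[where f = f, OF _ \<open>open S\<close> that Suc.prems(1)])
    show "(f has_derivative frechet_derivative f (at x)) (at x)"
      using Suc.prems(2) that by (simp add: frechet_derivative_works[symmetric])
  qed
  have "frechet_derivative f (at x) = frechet_derivative g (at x)" if "x \<in> S" for x
    using frechet_derivative_at[OF g[OF that]] .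
  then have "Ck_on k S (\<lambda>x. frechet_derivative g (at x) v)" for v
    using Suc.IH[of "\<lambda>x. frechet_derivative f (at x) v"] Suc.prems(2) by simp
  moreover have "g differentiable (at x)" if "x \<in> S" for x
    using g[OF that] unfolding differentiable_def by blast
  ultimately show ?case
    by simp
qed

text \<open>Uniqueness of the derivative lets an explicit candidate \<open>F\<close> replace
  \<open>frechet_derivative\<close>; together with \<open>Ck_on_SucE\<close> this keeps all later
  inductions free of it.\<close>

lemma Ck_on_SucI:
  assumes "open S" "\<And>x. x \<in> S \<Longrightarrow> (f has_derivative F x) (at x)" "\<And>v. Ck_on k S (\<lambda>x. F x v)"
  shows "Ck_on (Suc k) S f"
proof -
  have "F x = frechet_derivative f (at x)" if "x \<in> S" for x
    using frechet_derivative_at[OF assms(2)[OF that]] .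
  then have "Ck_on k S (\<lambda>x. frechet_derivative f (at x) v)" for v
    by (intro Ck_on_cong[OF assms(1) _ assms(3)[of v]]) simp
  then show ?thesis
    using assms(2) by (auto simp: differentiable_def)
qed

lemma Ck_on_SucD: "Ck_on (Suc k) S f \<Longrightarrow> Ck_on k S f"
proof (induction k arbitrary: f)
  case 0
  then show ?case
    by (auto intro!: continuous_at_imp_continuous_on differentiable_imp_continuous_within)
next
  case (Suc k)
  then have "Ck_on k S (\<lambda>x. frechet_derivative f (at x) v)" for v
    by (metis Ck_on.simps(2))
  with Suc.prems show ?case by simp
qed

lemma Ck_on_SucE:
  assumes "Ck_on (Suc k) S f"
  obtains F where "\<forall>x\<in>S. (f has_derivative F x) (at x)" "\<forall>v. Ck_on k S (\<lambda>x. F x v)"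
proof
  show "\<forall>x\<in>S. (f has_derivative frechet_derivative f (at x)) (at x)"
    using assms by (simp add: frechet_derivative_works[symmetric])
  show "\<forall>v. Ck_on k S (\<lambda>x. frechet_derivative f (at x) v)"
    using assms by simp
qed

lemma Ck_on_const: "open S \<Longrightarrow> Ck_on k S (\<lambda>x. c)"
proof (induction k arbitrary: c)
  case (Suc k)
  then show ?case by (intro Ck_on_SucI[where F = "\<lambda>_ _. 0"]) auto
qed simp

lemma Ck_on_bounded_linear:
  assumes "open S" "bounded_linear f"
  shows "Ck_on k S f"
proof (cases k)
  case 0
  then show ?thesis
    using assms(2) by (simp add: linear_continuous_on)
next
  case (Suc j)
  show ?thesis
    unfolding Suc
    by (rule Ck_on_SucI[OF assms(1) bounded_linear_imp_has_derivative[OF assms(2)]])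
       (rule Ck_on_const[OF assms(1)])
qed

lemma Ck_on_add:
  assumes "open S" "Ck_on k S f" "Ck_on k S g"
  shows "Ck_on k S (\<lambda>x. f x + g x)"
  using assms(2,3)
proof (induction k arbitrary: f g)
  case 0
  then show ?case by (simp add: continuous_on_add)
next
  case (Suc k)
  obtain F where "\<forall>x\<in>S. (f has_derivative F x) (at x)" "\<forall>v. Ck_on k S (\<lambda>x. F x v)"
    using Suc.prems(1) by (rule Ck_on_SucE)
  moreover obtain G where "\<forall>x\<in>S. (g has_derivative G x) (at x)" "\<forall>v. Ck_on k S (\<lambda>x. G x v)"
    using Suc.prems(2) by (rule Ck_on_SucE)
  ultimately show ?case
    by (intro Ck_on_SucI[OF assms(1), where F = "\<lambda>x v. F x v + G x v"] Suc.IH has_derivative_add) auto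
qed

lemma Ck_on_scaleR:
  fixes f :: "'a::real_normed_vector \<Rightarrow> real"
  assumes "open S" "Ck_on k S f" "Ck_on k S g"
  shows "Ck_on k S (\<lambda>x. f x *\<^sub>R g x)"
  using assms(2,3)
proof (induction k arbitrary: f g)
  case 0
  then show ?case by (simp add: continuous_on_scaleR)
next
  case (Suc k)
  obtain F where F: "\<forall>x\<in>S. (f has_derivative F x) (at x)" "\<forall>v. Ck_on k S (\<lambda>x. F x v)"
    using Suc.prems(1) by (rule Ck_on_SucE)
  obtain G where G: "\<forall>x\<in>S. (g has_derivative G x) (at x)" "\<forall>v. Ck_on k S (\<lambda>x. G x v)"
    using Suc.prems(2) by (rule Ck_on_SucE)
  \<comment> \<open>The product rule leaves \<open>f\<close> and \<open>g\<close> undifferentiated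
    in its terms, so they are first lowered from order \<open>Suc k\<close> to
    \<open>k\<close>.\<close>
  show ?case
    by (rule Ck_on_SucI[OF assms(1) has_derivative_scaleR[OF F(1)[rule_format] G(1)[rule_format]]])
       (simp_all add: Ck_on_add[OF assms(1)] Suc.IH F(2) G(2) Suc.prems[THEN Ck_on_SucD])
qed

lemma Ck_on_mult:
  fixes f g :: "'a::real_normed_vector \<Rightarrow> real"
  assumes "open S" "Ck_on k S f" "Ck_on k S g"
  shows "Ck_on k S (\<lambda>x. f x * g x)"
  using Ck_on_scaleR[OF assms] by simp

text \<open>With a real intermediate variable the chain rule becomes the product
  \<open>F x v * H (f x) 1\<close>. The direction at which \<open>H\<close> is evaluated is then the
  constant 1, so the induction hypothesis applies to that factor.\<close>

lemma Ck_on_compose_real: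
  fixes f :: "'a::real_normed_vector \<Rightarrow> real" and h :: "real \<Rightarrow> real"
  assumes "open S" "f ` S \<subseteq> T" "Ck_on k T h" "Ck_on k S f"
  shows "Ck_on k S (\<lambda>x. h (f x))"
  using assms(3,4)
proof (induction k arbitrary: h)
  case 0
  then show ?case
    using continuous_on_compose2[of T h S f] assms(2) by simp
next
  case (Suc k)
  obtain F where F: "\<forall>x\<in>S. (f has_derivative F x) (at x)" "\<forall>v. Ck_on k S (\<lambda>x. F x v)"
    using Suc.prems(2) by (rule Ck_on_SucE)
  obtain H where H: "\<forall>x\<in>T. (h has_derivative H x) (at x)" "\<forall>v. Ck_on k T (\<lambda>x. H x v)"
    using Suc.prems(1) by (rule Ck_on_SucE)
  have lin: "H x v = v * H x 1" if "x \<in> T" for x v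
    using linear_scale[OF has_derivative_linear[OF H(1)[rule_format, OF that]], of v 1] by simp
  show ?case
  proof (rule Ck_on_SucI[OF assms(1)])
    fix x assume x: "x \<in> S"
    then have "((\<lambda>x. h (f x)) has_derivative (\<lambda>v. H (f x) (F x v))) (at x)"
      using assms(2) by (intro has_derivative_compose[OF F(1)[rule_format] H(1)[rule_format]]) auto
    moreover have "(\<lambda>v. H (f x) (F x v)) = (\<lambda>v. F x v * H (f x) 1)"
      using x assms(2) by (intro ext lin) auto
    ultimately show "((\<lambda>x. h (f x)) has_derivative (\<lambda>v. F x v * H (f x) 1)) (at x)"
      by (simp only:)
  next
    show "Ck_on k S (\<lambda>x. F x v * H (f x) 1)" for v
      using F(2) Suc.IH[OF H(2)[rule_format] Suc.prems(2)[THEN Ck_on_SucD]]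
      by (simp add: Ck_on_mult[OF assms(1)])
  qed
qed

section \<open>Smoothness of powers, hyperbolic functions and the norm\<close>

lemma Ck_on_real_SucI:
  fixes h :: "real \<Rightarrow> real"
  assumes "open T" "\<And>t. t \<in> T \<Longrightarrow> (h has_real_derivative h' t) (at t)" "Ck_on k T h'"
  shows "Ck_on (Suc k) T h"
  by (rule Ck_on_SucI[where F = "\<lambda>t v. h' t * v"])
     (use assms in \<open>auto simp: has_field_derivative_def intro!: Ck_on_mult Ck_on_const\<close>)

text \<open>The exponent is generalized in the induction because differentiation lowers it. Real
  exponents cover the roots and reciprocals that occur below.\<close>

lemma Ck_on_powr: "Ck_on k {0<..} (\<lambda>t::real. t powr a)"
proof (induction k arbitrary: a)
  case 0
  show ?case by (auto intro!: continuous_intros)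
next
  case (Suc k)
  show ?case
    by (rule Ck_on_real_SucI[where h' = "\<lambda>t. a * t powr (a - 1)"])
       (auto intro!: has_real_derivative_powr Ck_on_mult Ck_on_const Suc.IH)
qed

lemma
  assumes "open S"
  shows Ck_on_sinh: "Ck_on k S (sinh :: real \<Rightarrow> real)"
    and Ck_on_cosh: "Ck_on k S (cosh :: real \<Rightarrow> real)"
proof (induction k)
  case 0
  show "Ck_on 0 S (sinh :: real \<Rightarrow> real)" "Ck_on 0 S (cosh :: real \<Rightarrow> real)"
    by (auto intro!: continuous_intros)
next
  case (Suc k)
  show "Ck_on (Suc k) S (sinh :: real \<Rightarrow> real)"
    using Suc assms by (intro Ck_on_real_SucI[where h' = cosh]) (auto intro!: derivative_eq_intros)
  show "Ck_on (Suc k) S (cosh :: real \<Rightarrow> real)"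
    using Suc assms by (intro Ck_on_real_SucI[where h' = sinh]) (auto intro!: derivative_eq_intros)
qed

lemma Ck_on_arsinh: "Ck_on k UNIV (arsinh :: real \<Rightarrow> real)"
proof (cases k)
  case 0
  then show ?thesis by (auto intro!: continuous_intros)
next
  case (Suc j)
  have d: "(arsinh has_real_derivative (x * x + 1) powr (- 1/2)) (at x)" for x :: real
    using arsinh_real_has_field_derivative[of x UNIV]
    by (simp add: power2_eq_square powr_minus_divide powr_half_sqrt)
  have id: "Ck_on j UNIV (\<lambda>x::real. x)"
    by (intro Ck_on_bounded_linear bounded_linear_ident) auto
  have "Ck_on j UNIV (\<lambda>x::real. (x * x + 1) powr (- 1/2))"
    by (rule Ck_on_compose_real[OF _ _ Ck_on_powr])
       (auto intro!: Ck_on_add Ck_on_mult Ck_on_const id add_nonneg_pos)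
  then show ?thesis
    unfolding Suc by (intro Ck_on_real_SucI[OF _ d]) auto
qed

lemma open_punctured: "open (punctured :: (real^'n) set)"
  by (auto simp: punctured_def)

text \<open>The derivative in direction \<open>v\<close> is \<open>(x \<bullet> v) / norm x\<close>,
  which again contains only the norm and a linear function, so order \<open>k\<close> of the norm
  yields order \<open>Suc k\<close>.\<close>

lemma Ck_on_norm: "Ck_on k punctured (norm :: real^'n \<Rightarrow> real)"
proof (induction k)
  case 0
  show ?case by (auto intro!: continuous_intros)
next
  case (Suc k)
  show ?case
  proof (rule Ck_on_SucI[OF open_punctured])
    fix x :: "real^'n" assume "x \<in> punctured"
    then have "x \<noteq> 0" by (simp add: punctured_def)
    from has_derivative_norm[OF this]
    show "(norm has_derivative (\<lambda>v. norm x powr (-1) * (x \<bullet> v))) (at x)"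
      by (rule has_derivative_eq_rhs)
         (auto simp: fun_eq_iff powr_minus sgn_div_norm inner_commute \<open>x \<noteq> 0\<close>)
  next
    show "Ck_on k punctured (\<lambda>x::real^'n. norm x powr (-1) * (x \<bullet> v))" for v
      by (intro Ck_on_mult[OF open_punctured] Ck_on_compose_real[OF open_punctured _ Ck_on_powr Suc]
           Ck_on_bounded_linear[OF open_punctured] bounded_linear_inner_left)
         (auto simp: punctured_def)
  qed
qed

lemma smooth_on_radial:
  assumes "\<And>k. Ck_on k {0<..} h"
  shows "smooth_on punctured (\<lambda>x::real^'n. h (norm x) *\<^sub>R x)"
  unfolding smooth_on_def
  by (intro allI Ck_on_scaleR[OF open_punctured] Ck_on_compose_real[OF open_punctured _ assms Ck_on_norm]
       Ck_on_bounded_linear[OF open_punctured] bounded_linear_ident)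
     (auto simp: punctured_def)

section \<open>The tension field of a rotationally symmetric map\<close>

text \<open>Formulas for the metrics and maps hold only off the origin; since \<open>- {0}\<close>
  is open, they may still be differentiated at \<open>x\<close>.\<close>

lemma pdiff_eqI:
  assumes "x \<noteq> 0" "\<And>z. z \<noteq> 0 \<Longrightarrow> f z = g z" "(g has_derivative F) (at x)"
  shows "pdiff i f x = F (axis i 1)"
proof -
  have "(f has_derivative F) (at x)"
    by (rule has_derivative_transform_within_open[OF assms(3), of "- {0}"]) (use assms(1,2) in auto)
  from frechet_derivative_at[OF this] show ?thesis
    by (simp add: pdiff_def)
qed

lemma has_derivative_radial:
  fixes x :: "real^'n"
  assumes "x \<noteq> 0" "(h has_real_derivative h') (at (norm x))"
  shows "((\<lambda>z. h (norm z)) has_derivative (\<lambda>v. h' / norm x * (x \<bullet> v))) (at x)"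
  using has_derivative_compose[OF has_derivative_norm[OF assms(1)] assms(2)[unfolded has_field_derivative_def]]
  by (rule has_derivative_eq_rhs) (simp add: fun_eq_iff sgn_div_norm inner_commute divide_inverse)

lemma sum_norm_sq: "(\<Sum>i\<in>UNIV. x $ i * x $ i) = (norm (x::real^'n))\<^sup>2"
  by (simp add: power2_norm_eq_inner inner_vec_def)

text \<open>The metric, its inverse and the relevant Jacobians all have the form a I + b x x^T; this
  is the action of such a matrix on a vector \<open>c\<close>.\<close>

lemma sum_rank_one:
  fixes x :: "real^'n"
  shows "(\<Sum>j\<in>UNIV. (a * (if i = j then 1 else 0) + b * x $ i * x $ j) * c j)
    = a * c i + b * x $ i * (\<Sum>j\<in>UNIV. x $ j * c j)"
proof -
  have "(\<Sum>j\<in>UNIV. (a * (if i = j then 1 else 0) + b * x $ i * x $ j) * c j)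
    = (\<Sum>j\<in>UNIV. (if i = j then a * c j else 0) + b * x $ i * (x $ j * c j))"
    by (intro sum.cong) (auto simp: algebra_simps)
  then show ?thesis
    by (simp add: sum.distrib sum_distrib_left)
qed

section \<open>The polar metric: inverse and first derivatives\<close>

lemma matrix_inv_eqI:
  fixes A B :: "real^'n^'n"
  assumes "A ** B = mat 1"
  shows "matrix_inv A = B"
proof -
  have "B ** A = mat 1"
    using assms matrix_left_right_inverse by blast
  \<comment> \<open>\<open>matrix_inv\<close> is a choice among two-sided inverses, and
    \<open>B\<close> witnesses that one exists.\<close>
  with assms have "A ** matrix_inv A = mat 1"
    unfolding matrix_inv_def by (metis (mono_tags, lifting) someI)
  then show ?thesis
    by (metis \<open>B ** A = mat 1\<close> matrix_mul_assoc matrix_mul_lid matrix_mul_rid)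
qed

text \<open>The Gram matrix has eigenvalue 1 along \<open>x\<close> and \<open>q\<close> on the
  orthogonal complement, where \<open>q\<close> compares the spheres of radius \<open>f r\<close>
  and \<open>r\<close>. The equation for \<open>q\<close> is a premise so that \<open>q\<close> can
  stay an atom in later algebra.\<close>

lemma polar_metric_eq:
  fixes x :: "real^'n"
  assumes "x \<noteq> 0" "q = (f (norm x) / norm x)\<^sup>2"
  shows "polar_metric f x $ i $ j
    = q * (if i = j then 1 else 0) + (1 - q) / (norm x)\<^sup>2 * x $ i * x $ j"
  using assms(1) by (simp add: polar_metric_explicit assms(2)[symmetric] algebra_simps diff_divide_distrib)

text \<open>The inverse has eigenvalues 1 along \<open>x\<close> and 1/q across it, so it is the
  same expression with \<open>q\<close> replaced by \<open>1 / q\<close>.\<close>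

lemma polar_metric_inverse:
  fixes x :: "real^'n"
  assumes "x \<noteq> 0" "q = (f (norm x) / norm x)\<^sup>2" "q \<noteq> 0"
  shows "matrix_inv (polar_metric f x) $ i $ j
    = 1 / q * (if i = j then 1 else 0) + (1 - 1 / q) / (norm x)\<^sup>2 * x $ i * x $ j"
proof -
  let ?B = "\<chi> i j. 1 / q * (if i = j then 1 else 0) + (1 - 1 / q) / (norm x)\<^sup>2 * x $ i * x $ j"
  have "(polar_metric f x ** ?B) $ i $ j = (mat 1 :: real^'n^'n) $ i $ j" for i j
  proof -
    have "(polar_metric f x ** ?B) $ i $ j
        = (\<Sum>k\<in>UNIV. (q * (if i = k then 1 else 0) + (1 - q) / (norm x)\<^sup>2 * x $ i * x $ k) * ?B $ k $ j)"
      by (simp add: matrix_matrix_mult_def polar_metric_eq[OF assms(1), of q f] assms(2))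
    also have "\<dots> = q * ?B $ i $ j
        + (1 - q) / (norm x)\<^sup>2 * x $ i * (\<Sum>k\<in>UNIV. ?B $ j $ k * x $ k)"
      by (subst sum_rank_one) (simp add: mult_ac eq_commute)
    \<comment> \<open>The radial vector \<open>x\<close> is an eigenvector with eigenvalue
      1.\<close>
    also have "(\<Sum>k\<in>UNIV. ?B $ j $ k * x $ k) = x $ j"
      using assms(1) by (simp only: vec_lambda_beta sum_rank_one sum_norm_sq) (simp add: field_simps)
    also have "q * ?B $ i $ j + (1 - q) / (norm x)\<^sup>2 * x $ i * x $ j = (if i = j then 1 else 0)"
      using assms(1,3) by (simp add: field_simps)
    finally show ?thesis
      by (simp add: mat_def)
  qed
  then have "polar_metric f x ** ?B = mat 1"
    by (simp add: vec_eq_iff)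
  from matrix_inv_eqI[OF this] show ?thesis by simp
qed

text \<open>Here \<open>q'\<close> is the derivative of \<open>(f t / t)\<^sup>2\<close> at
  \<open>r\<close>. The coefficient of the cubic term is the derivative of
  \<open>(1 - q) / r\<^sup>2\<close>, divided by \<open>r\<close> because the gradient of the norm
  is x / r.\<close>

lemma pdiff_polar_metric:
  fixes x :: "real^'n"
  assumes x: "x \<noteq> 0" and f: "(f has_real_derivative f') (at (norm x))"
    and r: "r = norm x" and q: "q = (f r / r)\<^sup>2" and q': "q' = 2 * f r * f' / r\<^sup>2 - 2 * (f r)\<^sup>2 / r ^ 3"
  shows "pdiff l (\<lambda>z. polar_metric f z $ i $ j) x =
    q' / r * x $ l * (if i = j then 1 else 0)
    + (- q' / r ^ 3 - 2 * (1 - q) / r ^ 4) * x $ l * x $ i * x $ j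
    + (1 - q) / r\<^sup>2 * ((if i = l then 1 else 0) * x $ j + (if j = l then 1 else 0) * x $ i)"
proof -
  define k where "k = (\<lambda>t. (f t / t)\<^sup>2)"
  have r0: "r > 0" using x r by simp
  have dk: "(k has_real_derivative q') (at (norm x))"
    unfolding k_def q' r using x
    by (auto intro!: derivative_eq_intros f simp: field_simps power2_eq_square power3_eq_cube)
  have kq: "k r = q"
    by (simp add: k_def q)
  have dw: "((\<lambda>t. (1 - k t) / t\<^sup>2) has_real_derivative (- q' / r\<^sup>2 - 2 * (1 - q) / r ^ 3)) (at (norm x))"
    using r0 unfolding r[symmetric]
    by (auto intro!: derivative_eq_intros dk[folded r] simp: kq field_simps eval_nat_numeral)
  have m: "polar_metric f z $ i $ j
      = k (norm z) * (if i = j then 1 else 0) + (1 - k (norm z)) / (norm z)\<^sup>2 * (z $ i * z $ j)"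
    if "z \<noteq> 0" for z :: "real^'n"
    using that polar_metric_eq[of z "k (norm z)" f] by (simp add: k_def)
  have "((\<lambda>z. k (norm z) * (if i = j then 1 else 0) + (1 - k (norm z)) / (norm z)\<^sup>2 * (z $ i * z $ j))
      has_derivative (\<lambda>v. q' / norm x * (x \<bullet> v) * (if i = j then 1 else 0)
       + ((1 - k (norm x)) / (norm x)\<^sup>2 * (x $ i * v $ j + v $ i * x $ j)
          + (- q' / r\<^sup>2 - 2 * (1 - q) / r ^ 3) / norm x * (x \<bullet> v) * (x $ i * x $ j)))) (at x)"
    by (intro has_derivative_add has_derivative_mult has_derivative_mult_left
          has_derivative_radial[OF x dk] has_derivative_radial[OF x dw]
          bounded_linear_imp_has_derivative bounded_linear_vec_nth)
  from pdiff_eqI[OF x m this, of l]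
  have "pdiff l (\<lambda>z. polar_metric f z $ i $ j) x = q' / norm x * x $ l * (if i = j then 1 else 0)
       + ((1 - k (norm x)) / (norm x)\<^sup>2 * (x $ i * axis l 1 $ j + axis l 1 $ i * x $ j)
          + (- q' / r\<^sup>2 - 2 * (1 - q) / r ^ 3) / norm x * x $ l * (x $ i * x $ j))"
    by (simp add: inner_axis)
  then show ?thesis
    using r0 by (simp add: r[symmetric] kq axis_def field_simps eval_nat_numeral)
qed

section \<open>Derivatives of a component of a rotationally symmetric map\<close>

lemma pdiff_radial_component:
  fixes x w :: "real^'n"
  assumes x: "x \<noteq> 0" and h: "\<And>z. z \<noteq> 0 \<Longrightarrow> h z = \<phi> (norm z) * (w \<bullet> z)"
    and \<phi>: "(\<phi> has_real_derivative \<phi>') (at (norm x))"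
  shows "pdiff i h x = \<phi>' / norm x * (w \<bullet> x) * x $ i + \<phi> (norm x) * w $ i"
proof -
  have "((\<lambda>z. \<phi> (norm z) * (w \<bullet> z)) has_derivative
      (\<lambda>v. \<phi> (norm x) * (w \<bullet> v) + \<phi>' / norm x * (x \<bullet> v) * (w \<bullet> x))) (at x)"
    by (intro has_derivative_mult has_derivative_radial[OF x \<phi>]
          bounded_linear_imp_has_derivative bounded_linear_inner_right)
  from pdiff_eqI[OF x h this, of i] show ?thesis
    by (simp add: inner_axis)
qed

text \<open>Writing the derivative of \<phi> as t \<psi> cancels the 1/r from differentiating the
  norm, so the first partial derivatives are again radial factors times polynomials in the
  coordinates.\<close>

lemma pdiff_pdiff_radial_component:
  fixes x w :: "real^'n"
  assumes x: "x \<noteq> 0" and h: "\<And>z. z \<noteq> 0 \<Longrightarrow> h z = \<phi> (norm z) * (w \<bullet> z)"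
    and \<phi>: "\<And>t. t > 0 \<Longrightarrow> (\<phi> has_real_derivative t * \<psi> t) (at t)"
    and \<psi>: "(\<psi> has_real_derivative \<psi>') (at (norm x))"
  shows "pdiff i (pdiff j h) x =
    \<psi>' / norm x * (w \<bullet> x) * x $ i * x $ j
    + \<psi> (norm x) * ((w \<bullet> x) * (if i = j then 1 else 0) + w $ i * x $ j + w $ j * x $ i)"
proof -
  have p: "pdiff j h z = \<psi> (norm z) * ((w \<bullet> z) * z $ j) + \<phi> (norm z) * w $ j"
    if "z \<noteq> 0" for z
    using pdiff_radial_component[OF _ h \<phi>, of z j] that by simp
  have \<phi>x: "(\<phi> has_real_derivative norm x * \<psi> (norm x)) (at (norm x))"
    using x by (intro \<phi>) simp
  have "((\<lambda>z. \<psi> (norm z) * ((w \<bullet> z) * z $ j) + \<phi> (norm z) * w $ j) has_derivative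
      (\<lambda>v. (\<psi> (norm x) * ((w \<bullet> x) * v $ j + (w \<bullet> v) * x $ j)
            + \<psi>' / norm x * (x \<bullet> v) * ((w \<bullet> x) * x $ j))
         + norm x * \<psi> (norm x) / norm x * (x \<bullet> v) * w $ j)) (at x)"
    by (intro has_derivative_add has_derivative_mult has_derivative_mult_left has_derivative_radial[OF x \<psi>]
          has_derivative_radial[OF x \<phi>x] bounded_linear_imp_has_derivative bounded_linear_inner_right
          bounded_linear_vec_nth)
  from pdiff_eqI[OF x p this, of i]
  have "pdiff i (pdiff j h) x = (\<psi> (norm x) * ((w \<bullet> x) * axis i 1 $ j + w $ i * x $ j)
      + \<psi>' / norm x * x $ i * ((w \<bullet> x) * x $ j)) + \<psi> (norm x) * x $ i * w $ j"
    using x by (simp add: inner_axis)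
  then show ?thesis
    by (simp add: axis_def algebra_simps)
qed

lemma christoffel_flat_metric:
  fixes x :: "real^'n"
  assumes x: "x \<noteq> 0"
  shows "christoffel flat_metric x k i j = 0"
proof -
  have "pdiff l (\<lambda>z :: real^'n. flat_metric z $ a $ b) x = 0" for l a b
    using pdiff_eqI[of x "\<lambda>z. flat_metric z $ a $ b" "\<lambda>z. mat 1 $ a $ b" "\<lambda>_. 0" l] x
    by (simp add: flat_metric_eq_mat_1)
  then show ?thesis
    by (simp add: christoffel_def)
qed

lemma sum_sum_rank_one:
  fixes x :: "real^'n"
  shows "(\<Sum>i\<in>UNIV. \<Sum>j\<in>UNIV. (a * (if i = j then 1 else 0) + b * x $ i * x $ j) * c i j)
    = a * (\<Sum>i\<in>UNIV. c i i) + b * (\<Sum>i\<in>UNIV. \<Sum>j\<in>UNIV. x $ i * x $ j * c i j)"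
  unfolding sum_rank_one sum.distrib by (simp add: sum_distrib_left mult_ac)

text \<open>Here \<open>\<alpha> \<delta>\<^sub>i\<^sub>j + \<beta> x\<^sub>i x\<^sub>j + \<gamma> (w\<^sub>i x\<^sub>j + w\<^sub>j x\<^sub>i)\<close> is the covariant Hessian of \<open>\<phi>(|x|) (w \<bullet> x)\<close> with
  \<open>p = w \<bullet> x\<close> and \<open>\<phi> = y / r\<close>, \<open>\<psi> = \<phi>' / r\<close>; the metric has Gram matrix \<open>q \<delta>\<^sub>i\<^sub>j + \<omega> x\<^sub>i x\<^sub>j\<close>, and \<open>Q\<close>, \<open>W\<close>
  are \<open>q' / r\<close>, \<open>\<omega>' / r\<close>. The left-hand side is the metric trace of that Hessian.\<close>

lemma laplacian_radial_algebra:
  fixes r f f' y y' y'' m p :: real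
  assumes "r \<noteq> 0" "f \<noteq> 0"
    and "q = (f / r)\<^sup>2" "q' = 2 * f * f' / r\<^sup>2 - 2 * f\<^sup>2 / r ^ 3"
    and "\<phi> = y / r" "\<psi> = (y' - y / r) / r\<^sup>2" "\<psi>' = y'' / r\<^sup>2 - 3 * y' / r ^ 3 + 3 * y / r ^ 4"
    and "Q = q' / r" "W = - q' / r ^ 3 - 2 * (1 - q) / r ^ 4" "\<omega> = (1 - q) / r\<^sup>2" "E = p * y'"
    and "\<mu> = \<psi> * p / q + (1 - 1 / q) / r\<^sup>2 * E" "\<nu> = \<phi> / q"
    and "\<alpha> = \<psi> * p + Q * E / 2 - \<omega> * E" "\<beta> = \<psi>' / r * p - Q * \<mu> - W * E / 2" "\<gamma> = \<psi> - Q * \<nu> / 2"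
  shows "(1 + m / q) * \<alpha> + \<beta> * r\<^sup>2 + 2 * \<gamma> * p
    = p / r * (y'' + m * (f' / f) * y' - m * y / f\<^sup>2)"
  using assms(1,2) unfolding assms(3-)
  by (simp add: field_simps eval_nat_numeral)
text \<open>Since \<open>u x\<close> is nonzero, the Christoffel symbols of the target vanish there,
  and each component of the tension is the Laplacian of a function
  \<open>h z = \<phi> (norm z) * (w \<bullet> z)\<close>, with \<open>w\<close> a row of
  \<open>A\<close> and \<open>\<phi> = y / r\<close>. Its covariant Hessian is computed and then
  traced with the inverse metric.\<close>

lemma tension_radial:
  fixes u :: "real^'n \<Rightarrow> real^'n" and A :: "real^'n^'n"
  assumes u: "\<And>z. z \<noteq> 0 \<Longrightarrow> u z = y (norm z) *\<^sub>R (A *v sgn z)"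
    and y: "\<And>t. t > 0 \<Longrightarrow> (y has_real_derivative y' t) (at t)"
    and y': "(y' has_real_derivative y'') (at (norm x))"
    and f: "(f has_real_derivative f') (at (norm x))" "f (norm x) \<noteq> 0"
    and x: "x \<noteq> 0" "u x \<noteq> 0"
  shows "tension (polar_metric f) flat_metric u x =
    (y'' + real (CARD('n) - 1) * (f' / f (norm x)) * y' (norm x)
      - real (CARD('n) - 1) * y (norm x) / (f (norm x))\<^sup>2) *\<^sub>R (A *v sgn x)"
proof -
  define r where "r = norm x"
  have r: "r > 0" using x by (simp add: r_def)
  define fr where "fr = f r"
  have fr: "fr \<noteq> 0" using f by (simp add: fr_def r_def)
  define q where "q = (fr / r)\<^sup>2"
  have q: "q \<noteq> 0" using r fr by (simp add: q_def)
  define q' where "q' = 2 * fr * f' / r\<^sup>2 - 2 * fr\<^sup>2 / r ^ 3"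
  define \<phi> where "\<phi> = (\<lambda>t. y t / t)"
  define \<psi> where "\<psi> = (\<lambda>t. (y' t - y t / t) / t\<^sup>2)"
  define \<psi>' where "\<psi>' = y'' / r\<^sup>2 - 3 * y' r / r ^ 3 + 3 * y r / r ^ 4"
  define Q where "Q = q' / r"
  define W where "W = - q' / r ^ 3 - 2 * (1 - q) / r ^ 4"
  define \<omega> where "\<omega> = (1 - q) / r\<^sup>2"
  have d\<phi>: "(\<phi> has_real_derivative t * \<psi> t) (at t)" if "t > 0" for t
    using that y[OF that] unfolding \<phi>_def \<psi>_def
    by (auto intro!: derivative_eq_intros simp: field_simps power2_eq_square)
  have d\<psi>: "(\<psi> has_real_derivative \<psi>') (at (norm x))"
    using r y[OF r] y' unfolding \<psi>_def \<psi>'_def r_def[symmetric]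
    by (auto intro!: derivative_eq_intros simp: field_simps eval_nat_numeral)
  let ?\<delta> = "\<lambda>i j. if i = j then 1 else (0::real)"
  define H where "H = (\<lambda>i j. 1 / q * ?\<delta> i j + (1 - 1 / q) / r\<^sup>2 * x $ i * x $ j)"
  have H: "matrix_inv (polar_metric f x) $ i $ j = H i j" for i j
    unfolding H_def r_def
    by (rule polar_metric_inverse) (use x q in \<open>auto simp: q_def fr_def r_def\<close>)
  have Hsym: "H i j = H j i" for i j
    by (simp add: H_def)
  have dg: "pdiff l (\<lambda>z. polar_metric f z $ i $ j) x =
      Q * x $ l * ?\<delta> i j + W * x $ l * x $ i * x $ j + \<omega> * (?\<delta> i l * x $ j + ?\<delta> j l * x $ i)" for l i j
    unfolding Q_def W_def \<omega>_def
    by (rule pdiff_polar_metric[OF x(1) f(1)]) (simp_all add: r_def q_def q'_def fr_def)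
  show ?thesis
  proof (intro vec_eq_iff[THEN iffD2] allI)
    fix a
    define w where "w = row a A"
    define h where "h = (\<lambda>z. u z $ a)"
    have h: "h z = \<phi> (norm z) * (w \<bullet> z)" if "z \<noteq> 0" for z
      using that by (simp add: h_def u \<phi>_def w_def sgn_div_norm matrix_vector_mult_scaleR divide_inverse
          matrix_vector_mul_component row_def vec_nth_inverse)
    define p where "p = w \<bullet> x"
    \<comment> \<open>\<open>E\<close> is the derivative of \<open>h\<close> along the position
      vector \<open>x\<close>; \<open>\<mu>\<close> and \<open>\<nu>\<close> are the coefficients
      along \<open>x\<close> and \<open>w\<close> of the metric gradient of
      \<open>h\<close>.\<close>
    define E where "E = p * y' r"
    define \<mu> where "\<mu> = \<psi> r * p / q + (1 - 1 / q) / r\<^sup>2 * E"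
    define \<nu> where "\<nu> = \<phi> r / q"
    define \<alpha> where "\<alpha> = \<psi> r * p + Q * E / 2 - \<omega> * E"
    define \<beta> where "\<beta> = \<psi>' / r * p - Q * \<mu> - W * E / 2"
    define \<gamma> where "\<gamma> = \<psi> r - Q * \<nu> / 2"
    have xx: "(\<Sum>i\<in>UNIV. x $ i * x $ i) = r\<^sup>2"
      by (simp add: sum_norm_sq r_def)
    have xw: "(\<Sum>i\<in>UNIV. x $ i * w $ i) = p" "(\<Sum>i\<in>UNIV. w $ i * x $ i) = p"
      by (simp_all add: p_def inner_vec_def mult.commute)
    have dh: "pdiff i h x = \<psi> r * p * x $ i + \<phi> r * w $ i" for i
      using pdiff_radial_component[OF x(1) h d\<phi>, of i] r by (simp add: r_def p_def)
    have ddh: "pdiff i (pdiff j h) x = \<psi>' / r * p * x $ i * x $ j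
        + \<psi> r * (p * ?\<delta> i j + w $ i * x $ j + w $ j * x $ i)" for i j
      using pdiff_pdiff_radial_component[OF x(1) h d\<phi> d\<psi>, of i j] by (simp add: r_def p_def)
    have xdh: "(\<Sum>k\<in>UNIV. x $ k * pdiff k h x) = E"
    proof -
      have "(\<Sum>k\<in>UNIV. x $ k * pdiff k h x)
          = \<psi> r * p * (\<Sum>k\<in>UNIV. x $ k * x $ k) + \<phi> r * (\<Sum>k\<in>UNIV. x $ k * w $ k)"
        by (simp add: dh sum.distrib sum_distrib_left algebra_simps)
      then show ?thesis
        using r by (simp add: xx xw E_def \<phi>_def \<psi>_def field_simps)
    qed
    have D: "(\<Sum>k\<in>UNIV. H l k * pdiff k h x) = \<mu> * x $ l + \<nu> * w $ l" for l
      unfolding H_def sum_rank_one xdh by (simp add: dh \<mu>_def \<nu>_def algebra_simps add_divide_distrib)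
    \<comment> \<open>The inverse metric fixes \<open>x\<close>, so pairing \<open>x\<close> with
      the metric gradient gives the same value as pairing it with the partial derivatives.\<close>
    have xD: "(\<Sum>l\<in>UNIV. x $ l * (\<mu> * x $ l + \<nu> * w $ l)) = E"
    proof -
      have "(\<Sum>l\<in>UNIV. x $ l * (\<mu> * x $ l + \<nu> * w $ l))
          = \<mu> * (\<Sum>k\<in>UNIV. x $ k * x $ k) + \<nu> * (\<Sum>k\<in>UNIV. x $ k * w $ k)"
        by (simp add: sum.distrib sum_distrib_left algebra_simps)
      then show ?thesis
        using r q by (simp add: xx xw E_def \<mu>_def \<nu>_def \<phi>_def \<psi>_def field_simps)
    qed
    have \<Gamma>: "(\<Sum>k\<in>UNIV. christoffel (polar_metric f) x k i j * pdiff k h x)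
        = Q / 2 * (x $ i * (\<mu> * x $ j + \<nu> * w $ j) + x $ j * (\<mu> * x $ i + \<nu> * w $ i))
          + ((\<omega> - Q / 2) * ?\<delta> i j + W / 2 * x $ i * x $ j) * E" for i j
    proof -
      \<comment> \<open>\<open>b\<close> is twice the Christoffel symbol of the first kind. By
        symmetry of \<open>H\<close> the raised index can be moved onto the derivatives of
        \<open>h\<close>, so \<open>b / 2\<close> is contracted with the gradient from
        \<open>D\<close> and no symbol of the second kind is expanded.\<close>
      define b where "b = (\<lambda>l. Q * (x $ i * ?\<delta> j l + x $ j * ?\<delta> i l)
          + ((2 * \<omega> - Q) * ?\<delta> i j + W * x $ i * x $ j) * x $ l)"
      have b: "pdiff i (\<lambda>z. polar_metric f z $ j $ l) x + pdiff j (\<lambda>z. polar_metric f z $ i $ l) x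
          - pdiff l (\<lambda>z. polar_metric f z $ i $ j) x = b l" for l
        unfolding dg b_def by (simp add: algebra_simps)
      have \<delta>D: "(\<Sum>l\<in>UNIV. ?\<delta> m l * (\<mu> * x $ l + \<nu> * w $ l)) = \<mu> * x $ m + \<nu> * w $ m" for m
        using sum_rank_one[of 1 m 0 x "\<lambda>l. \<mu> * x $ l + \<nu> * w $ l"] by simp
      have "(\<Sum>k\<in>UNIV. christoffel (polar_metric f) x k i j * pdiff k h x)
          = (\<Sum>k\<in>UNIV. \<Sum>l\<in>UNIV. 1 / 2 * (b l * (H l k * pdiff k h x)))"
        unfolding christoffel_def b H sum_distrib_left sum_distrib_right
        by (intro sum.cong refl) (simp add: Hsym mult_ac)
      also have "\<dots> = (\<Sum>l\<in>UNIV. 1 / 2 * (b l * (\<mu> * x $ l + \<nu> * w $ l)))"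
        unfolding D[symmetric] sum_distrib_left by (rule sum.swap)
      also have "\<dots> = (\<Sum>l\<in>UNIV. Q / 2 * (x $ i * (?\<delta> j l * (\<mu> * x $ l + \<nu> * w $ l)))
            + Q / 2 * (x $ j * (?\<delta> i l * (\<mu> * x $ l + \<nu> * w $ l)))
            + ((\<omega> - Q / 2) * ?\<delta> i j + W / 2 * x $ i * x $ j) * (x $ l * (\<mu> * x $ l + \<nu> * w $ l)))"
        by (intro sum.cong refl) (simp add: b_def field_simps)
      also have "\<dots> = Q / 2 * (x $ i * (\<Sum>l\<in>UNIV. ?\<delta> j l * (\<mu> * x $ l + \<nu> * w $ l)))
            + Q / 2 * (x $ j * (\<Sum>l\<in>UNIV. ?\<delta> i l * (\<mu> * x $ l + \<nu> * w $ l)))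
            + ((\<omega> - Q / 2) * ?\<delta> i j + W / 2 * x $ i * x $ j) * E"
        unfolding sum.distrib xD[symmetric] sum_distrib_left ..
      finally show ?thesis
        unfolding \<delta>D by (simp add: algebra_simps)
    qed
    have B: "pdiff i (pdiff j h) x - (\<Sum>k\<in>UNIV. christoffel (polar_metric f) x k i j * pdiff k h x)
        = \<alpha> * ?\<delta> i j + \<beta> * x $ i * x $ j + \<gamma> * (w $ i * x $ j + w $ j * x $ i)" for i j
      unfolding \<Gamma> ddh by (simp add: \<alpha>_def \<beta>_def \<gamma>_def field_simps)
    \<comment> \<open>The metric trace is 1/q times the Euclidean trace, found in
      \<open>tr1\<close>, plus \<open>(1 - 1 / q) / r\<^sup>2\<close> times the value of the Hessian
      at the pair (x, x), found in \<open>tr2\<close>.\<close>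
    have tr1: "(\<Sum>i\<in>UNIV. \<alpha> * ?\<delta> i i + \<beta> * x $ i * x $ i + \<gamma> * (w $ i * x $ i + w $ i * x $ i))
        = real CARD('n) * \<alpha> + \<beta> * r\<^sup>2 + 2 * \<gamma> * p"
    proof -
      have "(\<Sum>i\<in>UNIV. \<alpha> * ?\<delta> i i + \<beta> * x $ i * x $ i + \<gamma> * (w $ i * x $ i + w $ i * x $ i))
          = real CARD('n) * \<alpha> + \<beta> * (\<Sum>i\<in>UNIV. x $ i * x $ i) + 2 * \<gamma> * (\<Sum>i\<in>UNIV. w $ i * x $ i)"
        by (simp add: sum.distrib sum_distrib_left algebra_simps)
      then show ?thesis by (simp add: xx xw)
    qed
    have tr2: "(\<Sum>i\<in>UNIV. \<Sum>j\<in>UNIV. x $ i * x $ j *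
          (\<alpha> * ?\<delta> i j + \<beta> * x $ i * x $ j + \<gamma> * (w $ i * x $ j + w $ j * x $ i)))
        = \<alpha> * r\<^sup>2 + \<beta> * r ^ 4 + 2 * \<gamma> * p * r\<^sup>2"
    proof -
      have "(\<Sum>j\<in>UNIV. x $ i * x $ j *
            (\<alpha> * ?\<delta> i j + \<beta> * x $ i * x $ j + \<gamma> * (w $ i * x $ j + w $ j * x $ i)))
          = \<alpha> * (x $ i * x $ i) + \<beta> * r\<^sup>2 * (x $ i * x $ i) + \<gamma> * r\<^sup>2 * (w $ i * x $ i)
            + \<gamma> * p * (x $ i * x $ i)" for i
      proof -
        have "(\<Sum>j\<in>UNIV. x $ i * x $ j *
              (\<alpha> * ?\<delta> i j + \<beta> * x $ i * x $ j + \<gamma> * (w $ i * x $ j + w $ j * x $ i)))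
            = (\<Sum>j\<in>UNIV. (\<alpha> * ?\<delta> i j + \<beta> * x $ i * x $ j) * (x $ i * x $ j))
              + \<gamma> * (w $ i * x $ i) * (\<Sum>j\<in>UNIV. x $ j * x $ j)
              + \<gamma> * (x $ i * x $ i) * (\<Sum>j\<in>UNIV. w $ j * x $ j)"
          unfolding sum_distrib_left sum.distrib[symmetric]
          by (intro sum.cong refl) (simp add: algebra_simps)
        also have "(\<Sum>j\<in>UNIV. x $ j * (x $ i * x $ j)) = x $ i * r\<^sup>2"
          unfolding xx[symmetric] sum_distrib_left by (intro sum.cong) auto
        ultimately show ?thesis
          unfolding sum_rank_one by (simp add: xx xw algebra_simps)
      qed
      then have "(\<Sum>i\<in>UNIV. \<Sum>j\<in>UNIV. x $ i * x $ j *
          (\<alpha> * ?\<delta> i j + \<beta> * x $ i * x $ j + \<gamma> * (w $ i * x $ j + w $ j * x $ i)))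
        = \<alpha> * r\<^sup>2 + \<beta> * r\<^sup>2 * r\<^sup>2 + \<gamma> * r\<^sup>2 * p + \<gamma> * p * r\<^sup>2"
        by (simp only: sum.distrib sum_distrib_left[symmetric] xx xw)
      then show ?thesis
        by (simp add: algebra_simps eval_nat_numeral)
    qed
    have "tension (polar_metric f) flat_metric u x $ a
        = (\<Sum>i\<in>UNIV. \<Sum>j\<in>UNIV. H i j *
           (\<alpha> * ?\<delta> i j + \<beta> * x $ i * x $ j + \<gamma> * (w $ i * x $ j + w $ j * x $ i)))"
      by (simp add: tension_def christoffel_flat_metric[OF x(2)] H B[unfolded h_def])
    also have "\<dots> = 1 / q * (real CARD('n) * \<alpha> + \<beta> * r\<^sup>2 + 2 * \<gamma> * p)
        + (1 - 1 / q) / r\<^sup>2 * (\<alpha> * r\<^sup>2 + \<beta> * r ^ 4 + 2 * \<gamma> * p * r\<^sup>2)"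
      unfolding H_def sum_sum_rank_one tr1 tr2 ..
    also have "\<dots> = (1 + real (CARD('n) - 1) / q) * \<alpha> + \<beta> * r\<^sup>2 + 2 * \<gamma> * p"
      using r q by (simp add: of_nat_diff field_simps eval_nat_numeral)
    also have "\<dots> = p / r * (y'' + real (CARD('n) - 1) * (f' / fr) * y' r - real (CARD('n) - 1) * y r / fr\<^sup>2)"
      by (rule laplacian_radial_algebra[OF _ fr q_def q'_def, of "\<phi> r" _ "\<psi> r" _ \<psi>' _ Q W \<omega> E _ \<mu> \<nu> \<alpha> \<beta> \<gamma>])
         (use r in \<open>simp_all add: \<phi>_def \<psi>_def \<psi>'_def Q_def W_def \<omega>_def E_def \<mu>_def \<nu>_def \<alpha>_def \<beta>_def \<gamma>_def\<close>)
    also have "p / r = (A *v sgn x) $ a"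
      by (simp add: p_def w_def r_def sgn_div_norm matrix_vector_mult_scaleR divide_inverse
          matrix_vector_mul_component row_def)
    finally show "tension (polar_metric f) flat_metric u x $ a =
      ((y'' + real (CARD('n) - 1) * (f' / f (norm x)) * y' (norm x)
        - real (CARD('n) - 1) * y (norm x) / (f (norm x))\<^sup>2) *\<^sub>R (A *v sgn x)) $ a"
      by (simp add: fr_def r_def mult.commute)
  qed
qed

section \<open>The Jacobian determinant\<close>

text \<open>The eigenvalues are \<open>a\<close>, on the complement of \<open>x\<close>, and
  \<open>a + b * (norm x)\<^sup>2\<close>, along \<open>x\<close>.\<close>

lemma det_scalar_plus_rank_one:
  fixes x :: "real^'n"
  assumes "x \<noteq> 0"
  shows "det (\<chi> i j. a * (if i = j then 1 else 0) + b * x $ i * x $ j :: real^'n^'n)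
    = a ^ (CARD('n) - 1) * (a + b * (norm x)\<^sup>2)"
proof -
  define M where "M = (\<chi> i j. a * (if i = j then 1 else 0) + b * x $ i * x $ j :: real^'n^'n)"
  have M: "M *v v = a *\<^sub>R v + (b * (x \<bullet> v)) *\<^sub>R x" for v
    unfolding vec_eq_iff M_def matrix_vector_mult_def vec_lambda_beta sum_rank_one
    by (simp add: inner_vec_def mult_ac)
  obtain k :: 'n where True by simp
  have "norm (axis k 1 :: real^'n) = 1" "norm (sgn x) = 1"
    using assms by (simp_all add: norm_sgn)
  then obtain g :: "real^'n \<Rightarrow> real^'n" where g: "orthogonal_transformation g" and gk: "g (axis k 1) = sgn x"
    by (rule orthogonal_transformation_exists_1)
  have lin: "linear g" and inner: "\<And>v w. g v \<bullet> g w = v \<bullet> w"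
    using g unfolding orthogonal_transformation_def by blast+
  have x: "norm x *\<^sub>R g (axis k 1) = x"
    by (simp add: gk sgn_div_norm assms)
  define D where "D = (\<chi> i j. if i = j then (if i = k then a + b * (norm x)\<^sup>2 else a) else 0 :: real^'n^'n)"
  have D: "D *v v = a *\<^sub>R v + (b * (norm x)\<^sup>2 * v $ k) *\<^sub>R axis k 1" for v
  proof (intro vec_eq_iff[THEN iffD2] allI)
    fix i
    have "(D *v v) $ i = (\<Sum>j\<in>UNIV. if i = j then (if i = k then a + b * (norm x)\<^sup>2 else a) * v $ j else 0)"
      unfolding D_def matrix_vector_mult_def vec_lambda_beta by (intro sum.cong) auto
    then show "(D *v v) $ i = (a *\<^sub>R v + (b * (norm x)\<^sup>2 * v $ k) *\<^sub>R axis k 1) $ i"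
      by (simp add: axis_def algebra_simps)
  qed
  have g': "matrix g *v v = g v" for v
    using lin by (simp add: matrix_works)
  \<comment> \<open>\<open>g\<close> maps a coordinate axis to the direction of \<open>x\<close>, so it conjugates \<open>M\<close> to the diagonal matrix \<open>D\<close>.\<close>
  have "(M ** matrix g) *v v = (matrix g ** D) *v v" for v
  proof -
    have "x \<bullet> g v = norm x * (g (axis k 1) \<bullet> g v)"
      unfolding inner_scaleR_left[symmetric] x ..
    then have "M *v g v = a *\<^sub>R g v + (b * (norm x * v $ k)) *\<^sub>R (norm x *\<^sub>R g (axis k 1))"
      unfolding x M by (simp add: inner inner_axis')
    also have "\<dots> = g (D *v v)"
      by (simp add: D linear_add[OF lin] linear_scale[OF lin] power2_eq_square mult_ac)
    finally show ?thesis
      by (simp add: g' flip: matrix_vector_mul_assoc)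
  qed
  then have "M ** matrix g = matrix g ** D"
    by (simp add: matrix_eq)
  then have "det M * det (matrix g) = det (matrix g) * det D"
    by (metis det_mul)
  moreover have "det (matrix g) \<noteq> 0"
    using orthogonal_transformation_det[OF g] by auto
  ultimately have "det M = det D" by simp
  also have "\<dots> = (\<Prod>i\<in>UNIV. if i = k then a + b * (norm x)\<^sup>2 else a)"
    by (subst det_diagonal) (simp_all add: D_def)
  also have "\<dots> = (a + b * (norm x)\<^sup>2) * (\<Prod>i\<in>UNIV - {k}. a)"
    by (subst prod.remove[of _ k]) (auto intro: prod.cong)
  finally show ?thesis
    by (simp add: M_def mult.commute)
qed

text \<open>The derivative is \<open>A\<close> composed with a symmetric map that stretches by y / r
  across \<open>x\<close> and by \<open>y'\<close> along it. For a rotation and positive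
  \<open>y\<close>, the sign of the determinant is therefore that of \<open>y'\<close>.\<close>

lemma det_jacobian_radial:
  fixes u :: "real^'n \<Rightarrow> real^'n" and A :: "real^'n^'n"
  assumes u: "\<And>z. z \<noteq> 0 \<Longrightarrow> u z = y (norm z) *\<^sub>R (A *v sgn z)"
    and y: "(y has_real_derivative y') (at (norm x))" and x: "x \<noteq> 0"
  shows "det (jacobian u (at x)) = det A * (y (norm x) / norm x) ^ (CARD('n) - 1) * y'"
proof -
  define r where "r = norm x"
  have r: "r > 0" using x by (simp add: r_def)
  define b where "b = (y' - y r / r) / r\<^sup>2"
  have "((\<lambda>t. y t / t) has_real_derivative r * b) (at r)"
    using r y unfolding b_def r_def[symmetric]
    by (auto intro!: derivative_eq_intros simp: field_simps power2_eq_square)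
  from has_derivative_radial[OF x this[unfolded r_def], folded r_def]
  have "((\<lambda>z. (y (norm z) / norm z) *\<^sub>R (A *v z)) has_derivative
      (\<lambda>v. (y (norm x) / norm x) *\<^sub>R (A *v v) + (r * b / r * (x \<bullet> v)) *\<^sub>R (A *v x))) (at x)"
    by (intro has_derivative_scaleR bounded_linear_imp_has_derivative matrix_vector_mul_bounded_linear)
  then have "(u has_derivative
      (\<lambda>v. (y (norm x) / norm x) *\<^sub>R (A *v v) + (r * b / r * (x \<bullet> v)) *\<^sub>R (A *v x))) (at x)"
    by (rule has_derivative_transform_within_open[where s = "- {0}"])
       (use x in \<open>auto simp: u sgn_div_norm matrix_vector_mult_scaleR divide_inverse\<close>)
  then have "jacobian u (at x)
      = matrix (\<lambda>v. (y (norm x) / norm x) *\<^sub>R (A *v v) + (r * b / r * (x \<bullet> v)) *\<^sub>R (A *v x))"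
    unfolding jacobian_def by (intro arg_cong[where f = matrix] frechet_derivative_at[symmetric])
  also have "\<dots> = matrix (\<lambda>v. (A ** (\<chi> i j. y r / r * (if i = j then 1 else 0) + b * x $ i * x $ j)) *v v)"
  proof (rule arg_cong[where f = matrix], rule ext)
    fix v
    have "(\<chi> i j. y r / r * (if i = j then 1 else 0) + b * x $ i * x $ j) *v v
        = (y r / r) *\<^sub>R v + (b * (x \<bullet> v)) *\<^sub>R x"
      by (simp only: vec_eq_iff matrix_vector_mult_def vec_lambda_beta sum_rank_one)
         (simp add: inner_vec_def mult_ac)
    then show "(y (norm x) / norm x) *\<^sub>R (A *v v) + (r * b / r * (x \<bullet> v)) *\<^sub>R (A *v x)
        = (A ** (\<chi> i j. y r / r * (if i = j then 1 else 0) + b * x $ i * x $ j)) *v v"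
      using r by (simp add: matrix_vector_mult_scaleR matrix_vector_right_distrib r_def
          flip: matrix_vector_mul_assoc)
  qed
  also have "det \<dots> = det A * ((y r / r) ^ (CARD('n) - 1) * (y r / r + b * r\<^sup>2))"
    by (simp only: matrix_of_matrix_vector_mul det_mul det_scalar_plus_rank_one[OF x] r_def)
  finally show ?thesis
    using r by (simp add: b_def r_def)
qed

section \<open>Uniqueness and existence of the profile\<close>

text \<open>A solution of y'' + p y' = q y on the positive half-line. Decay at infinity is the
  boundary condition that leaves only one free constant when \<open>q\<close> is positive.\<close>

definition decaying_solution :: "(real \<Rightarrow> real) \<Rightarrow> (real \<Rightarrow> real) \<Rightarrow> (real \<Rightarrow> real) \<Rightarrow> bool" where
  "decaying_solution p q y \<longleftrightarrow> (\<exists>y' y''. \<forall>t>0. (y has_real_derivative y' t) (at t) \<and>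
      (y' has_real_derivative y'' t) (at t) \<and> y'' t + p t * y' t = q t * y t) \<and>
    (y \<longlongrightarrow> 0) at_top"

text \<open>Maximum principle: a positive value beyond \<open>a\<close> would force a positive
  interior maximum \<open>c\<close>, where \<open>z' c = 0\<close> and the equation gives
  \<open>z'' c = q c * z c > 0\<close>, which is impossible.\<close>

lemma decaying_solution_nonpos:
  assumes "decaying_solution p q z" and q: "\<And>t. t > 0 \<Longrightarrow> q t > 0"
    and a: "a > 0" "z a = 0" and s: "s \<ge> a"
  shows "z s \<le> 0"
proof (rule ccontr)
  obtain z' z'' where zz: "\<forall>t>0. (z has_real_derivative z' t) (at t) \<and>
      (z' has_real_derivative z'' t) (at t) \<and> z'' t + p t * z' t = q t * z t"
    and lim: "(z \<longlongrightarrow> 0) at_top"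
    using assms(1) unfolding decaying_solution_def by blast
  then have z: "\<And>t. t > 0 \<Longrightarrow> (z has_real_derivative z' t) (at t)"
    and z': "\<And>t. t > 0 \<Longrightarrow> (z' has_real_derivative z'' t) (at t)"
    and ode: "\<And>t. t > 0 \<Longrightarrow> z'' t + p t * z' t = q t * z t"
    by blast+
  assume "\<not> z s \<le> 0"
  then have zs: "z s > 0" by simp
  from order_tendstoD(2)[OF lim zs] obtain N where N: "\<And>t. t \<ge> N \<Longrightarrow> z t < z s"
    by (auto simp: eventually_at_top_linorder)
  \<comment> \<open>Decay makes \<open>z R < z s\<close>, so the maximum over \<open>{a..R}\<close>
    is not at \<open>R\<close>; it is not at \<open>a\<close> because
    \<open>z a = 0\<close>.\<close>
  define R where "R = max N (s + 1)"
  have "continuous_on {a..R} z"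
    by (rule DERIV_continuous_on[where D = z'])
       (use z a(1) in \<open>auto intro: has_field_derivative_at_within\<close>)
  moreover have "{a..R} \<noteq> {}"
    using s by (simp add: R_def)
  ultimately obtain c where c: "c \<in> {a..R}" "\<And>t. t \<in> {a..R} \<Longrightarrow> z t \<le> z c"
    using continuous_attains_sup[OF compact_Icc] by blast
  have zc: "z c > 0"
    using c(2)[of s] s zs by (simp add: R_def le_max_iff_disj)
  have "z R < z c"
    using N[of R] c(2)[of s] s by (simp add: R_def le_max_iff_disj)
  with c(1) zc a have ac: "a < c" "c < R"
    by (auto simp: less_le)
  have c0: "c > 0" using ac a by simp
  have "z' c = 0"
    by (rule DERIV_local_max[OF z[OF c0], of "min (c - a) (R - c)"])
       (use ac c(2) in \<open>auto simp: abs_if split: if_splits\<close>)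
  then have "z'' c > 0"
    using ode[OF c0] q[OF c0] zc by simp
  \<comment> \<open>Just to the right of \<open>c\<close> the derivative \<open>z'\<close> is
    positive, so by the mean value theorem \<open>z\<close> exceeds its maximum there. Halving in
    \<open>h\<close> keeps the point strictly inside both bounds.\<close>
  from DERIV_pos_inc_right[OF z'[OF c0] this]
  obtain d where d: "d > 0" "\<And>h. 0 < h \<Longrightarrow> h < d \<Longrightarrow> z' (c + h) > 0"
    using \<open>z' c = 0\<close> by auto
  define h where "h = min d (R - c) / 2"
  have h: "0 < h" "h < d" "c + h < R"
    using d(1) ac by (auto simp: h_def min_def field_simps)
  obtain \<xi> where \<xi>: "c < \<xi>" "\<xi> < c + h" "z (c + h) - z c = h * z' \<xi>"
    using MVT2[of c "c + h" z z'] z c0 h by auto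
  have "z' \<xi> > 0"
    using d(2)[of "\<xi> - c"] \<xi> h by simp
  then have "z (c + h) > z c"
    using \<xi>(3) mult_pos_pos[OF h(1), of "z' \<xi>"] by simp
  then show False
    using c(2)[of "c + h"] h ac by auto
qed

lemma decaying_solution_lincomb:
  assumes "decaying_solution p q y" "decaying_solution p q z"
  shows "decaying_solution p q (\<lambda>t. k * y t - l * z t)"
proof -
  obtain y' y'' where y: "\<forall>t>0. (y has_real_derivative y' t) (at t) \<and>
      (y' has_real_derivative y'' t) (at t) \<and> y'' t + p t * y' t = q t * y t"
    using assms(1) unfolding decaying_solution_def by blast
  obtain z' z'' where z: "\<forall>t>0. (z has_real_derivative z' t) (at t) \<and>
      (z' has_real_derivative z'' t) (at t) \<and> z'' t + p t * z' t = q t * z t"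
    using assms(2) unfolding decaying_solution_def by blast
  have "((\<lambda>t. k * y t - l * z t) has_real_derivative k * y' t - l * z' t) (at t) \<and>
      ((\<lambda>t. k * y' t - l * z' t) has_real_derivative k * y'' t - l * z'' t) (at t) \<and>
      k * y'' t - l * z'' t + p t * (k * y' t - l * z' t) = q t * (k * y t - l * z t)"
    if "t > 0" for t
  proof (intro conjI)
    have "k * y'' t - l * z'' t + p t * (k * y' t - l * z' t)
        = k * (y'' t + p t * y' t) - l * (z'' t + p t * z' t)"
      by (simp add: algebra_simps)
    also have "\<dots> = k * (q t * y t) - l * (q t * z t)"
      using y z that by simp
    finally show "k * y'' t - l * z'' t + p t * (k * y' t - l * z' t) = q t * (k * y t - l * z t)"
      by (simp add: algebra_simps)
  qed (intro DERIV_diff DERIV_cmult, use y z that in simp_all)+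
  moreover have "((\<lambda>t. k * y t - l * z t) \<longlongrightarrow> k * 0 - l * 0) at_top"
    using assms unfolding decaying_solution_def by (intro tendsto_intros) auto
  ultimately show ?thesis
    unfolding decaying_solution_def by (intro conjI exI[of _ "\<lambda>t. k * y' t - l * z' t"]
        exI[of _ "\<lambda>t. k * y'' t - l * z'' t"] allI impI) auto
qed

lemma decaying_solution_unique:
  assumes y: "decaying_solution p q y" and z: "decaying_solution p q z"
    and q: "\<And>t. t > 0 \<Longrightarrow> q t > 0" and "a > 0" "s > 0"
  shows "y a * z s = z a * y s"
proof -
  \<comment> \<open>Stated for arbitrary \<open>y\<close> and \<open>z\<close>, so that exchanging
    them yields the opposite inequality.\<close>
  have *: "y a * z s - z a * y s \<le> 0"
    if y: "decaying_solution p q y" and z: "decaying_solution p q z" and "0 < a" "a \<le> s" for y z a s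
    by (rule decaying_solution_nonpos[OF decaying_solution_lincomb[OF z y, of "y a" "z a"] q])
       (use that in auto)
  have "y a * z s = z a * y s" if "0 < a" "a \<le> s" for a s
    using *[OF y z that] *[OF z y that] by simp
  \<comment> \<open>The identity is symmetric in \<open>a\<close> and \<open>s\<close>, which
    settles \<open>s < a\<close>.\<close>
  from this[of a s] this[of s a] show ?thesis
    using assms(4,5) by (cases "a \<le> s") (auto simp: mult.commute)
qed

section \<open>From the map to its profile\<close>

lemma rotation_matrix_norm: "rotation_matrix A \<Longrightarrow> norm (A *v v) = norm v"
  for A :: "real^'n^'n"
  using orthogonal_transformation_matrix[of "(*v) A"]
  by (simp add: rotation_matrix_def orthogonal_transformation_norm)

text \<open>\<open>rotationally_symmetric\<close> says nothing about regularity of \<open>y\<close>;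
  it is recovered by restricting \<open>u\<close> to a ray and projecting onto the image direction
  \<open>w\<close>. Harmonicity then gives the equation, reversal of orientation the strict
  decrease, and surjectivity the limit 0.\<close>

lemma profile_of_reversing_rotsym_harmonic_diffeo:
  fixes u :: "real^'n \<Rightarrow> real^'n"
  assumes u: "reversing_rotsym_harmonic_diffeo u"
  obtains y A where "rotation_matrix A" "\<forall>t>0. y t > 0"
    "\<forall>x\<in>punctured. u x = y (norm x) *\<^sub>R (A *v sgn x)"
    "decaying_solution (\<lambda>t. real (CARD('n) - 1) * (cosh t / sinh t)) (\<lambda>t. real (CARD('n) - 1) / (sinh t)\<^sup>2) y"
proof -
  have bij: "bij_betw u punctured punctured" and or: "orientation_reversing_on punctured u"
    and sm: "smooth_on punctured u"
    and ha: "\<And>x. x \<noteq> 0 \<Longrightarrow> tension (polar_metric sinh) flat_metric u x = 0"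
    using u by (auto simp: reversing_rotsym_harmonic_diffeo_def diffeomorphism_onto_def
        harmonic_map_on_def hyperbolic_metric_def punctured_def)
  obtain y A where A: "rotation_matrix A" and y: "\<forall>t>0. y t > 0"
    "\<forall>x\<in>punctured. u x = y (norm x) *\<^sub>R (A *v sgn x)"
    using u unfolding reversing_rotsym_harmonic_diffeo_def rotationally_symmetric_def by blast
  then have pos: "\<And>t. t > 0 \<Longrightarrow> y t > 0"
    and uy: "\<And>x. x \<noteq> 0 \<Longrightarrow> u x = y (norm x) *\<^sub>R (A *v sgn x)"
    by (auto simp: punctured_def)
  obtain k :: 'n where True by simp
  define e :: "real^'n" where "e = axis k 1"
  define w where "w = A *v e"
  have e: "norm e = 1" "e \<noteq> 0" by (auto simp: e_def axis_eq_0_iff)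
  have w: "w \<bullet> w = 1"
    using rotation_matrix_norm[OF A, of e] e by (simp add: w_def dot_square_norm)
  have yu: "y t = u (t *\<^sub>R e) \<bullet> w" if "t > 0" for t
    using that e w by (simp add: uy sgn_div_norm w_def)
  have "Ck_on (Suc (Suc 0)) punctured u"
    using sm by (simp add: smooth_on_def del: Ck_on.simps)
  then obtain F where F: "\<forall>x\<in>punctured. (u has_derivative F x) (at x)"
    and F1: "\<forall>v. Ck_on (Suc 0) punctured (\<lambda>x. F x v)"
    by (rule Ck_on_SucE)
  \<comment> \<open>The ray has constant velocity \<open>e\<close>, so the second derivative of
    \<open>y\<close> only involves the derivative of \<open>F\<close> in this fixed
    direction.\<close>
  obtain G where G: "\<forall>x\<in>punctured. ((\<lambda>x. F x e) has_derivative G x) (at x)"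
    using F1[rule_format, of e] by (rule Ck_on_SucE)
  have line: "((\<lambda>t. g (t *\<^sub>R e) \<bullet> w) has_real_derivative g' e \<bullet> w) (at t)"
    if "(g has_derivative g') (at (t *\<^sub>R e))" for g :: "real^'n \<Rightarrow> real^'n" and g' t
  proof -
    have "((\<lambda>t. t *\<^sub>R e) has_derivative (\<lambda>s. s *\<^sub>R e)) (at t)"
      by (intro bounded_linear_imp_has_derivative bounded_linear_scaleR_left)
    from has_derivative_inner_left[OF has_derivative_compose[OF this that], of w]
    show ?thesis
      unfolding has_field_derivative_def
      by (rule has_derivative_eq_rhs)
         (simp add: fun_eq_iff linear_scale[OF has_derivative_linear[OF that]] mult.commute)
  qed
  define y' where "y' = (\<lambda>t. F (t *\<^sub>R e) e \<bullet> w)"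
  define y'' where "y'' = (\<lambda>t. G (t *\<^sub>R e) e \<bullet> w)"
  have dy: "(y has_real_derivative y' t) (at t)" if "t > 0" for t
    unfolding y'_def
    by (rule has_field_derivative_transform_within_open[OF line, of _ _ _ "{0<..}"])
       (use F e that yu in \<open>auto simp: punctured_def\<close>)
  have dy': "(y' has_real_derivative y'' t) (at t)" if "t > 0" for t
    unfolding y'_def y''_def
    by (rule line) (use G e that in \<open>auto simp: punctured_def\<close>)
  have ode: "y'' t + real (CARD('n) - 1) * (cosh t / sinh t) * y' t
      = real (CARD('n) - 1) / (sinh t)\<^sup>2 * y t" if t: "t > 0" for t
  proof -
    define x where "x = t *\<^sub>R e"
    have x: "norm x = t" "x \<noteq> 0" using t e by (auto simp: x_def)
    have n: "norm (A *v sgn x) = 1"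
      using x by (simp add: rotation_matrix_norm[OF A] norm_sgn)
    then have "u x \<noteq> 0"
      using pos[OF t] x by (auto simp: uy)
    have "tension (polar_metric sinh) flat_metric u x =
      (y'' t + real (CARD('n) - 1) * (cosh t / sinh (norm x)) * y' (norm x)
        - real (CARD('n) - 1) * y (norm x) / (sinh (norm x))\<^sup>2) *\<^sub>R (A *v sgn x)"
      by (rule tension_radial[OF uy dy])
         (use x t dy' \<open>u x \<noteq> 0\<close> in \<open>auto intro!: derivative_eq_intros\<close>)
    then show ?thesis
      using ha[OF x(2)] n x by auto
  qed
  have neg: "y' t < 0" if t: "t > 0" for t
  proof -
    have "det (jacobian u (at (t *\<^sub>R e))) = (y t / t) ^ (CARD('n) - 1) * y' t"
      using det_jacobian_radial[OF uy dy, of "t *\<^sub>R e"] t e A by (simp add: rotation_matrix_def)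
    moreover have "det (jacobian u (at (t *\<^sub>R e))) < 0"
      using or t e by (simp add: orientation_reversing_on_def punctured_def)
    ultimately show ?thesis
      using pos[OF t] t by (simp add: mult_less_0_iff divide_less_0_iff)
  qed
  have lim: "(y \<longlongrightarrow> 0) at_top"
  proof (rule order_tendstoI)
    fix b :: real assume "b < 0"
    then show "\<forall>\<^sub>F t in at_top. b < y t"
      by (intro eventually_mono[OF eventually_gt_at_top[of 0]]) (use pos in force)
  next
    fix b :: real assume b: "0 < b"
    \<comment> \<open>Surjectivity provides a radius at which \<open>y\<close> equals
      \<open>b / 2\<close>; beyond it the decreasing \<open>y\<close> stays below
      \<open>b\<close>.\<close>
    then have "(b / 2) *\<^sub>R e \<in> u ` punctured"
      using bij e by (simp add: bij_betw_def punctured_def)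
    then obtain x where "x \<in> punctured" "(b / 2) *\<^sub>R e = u x"
      by blast
    then have x: "x \<noteq> 0" "u x = (b / 2) *\<^sub>R e"
      by (simp_all add: punctured_def)
    have "y (norm x) = norm (u x)"
      using pos[of "norm x"] x(1) by (simp add: uy rotation_matrix_norm[OF A] norm_sgn)
    also have "\<dots> = b / 2"
      unfolding x(2) using e b by simp
    finally have yx: "y (norm x) = b / 2" .
    have "y t < b" if "t > norm x" for t
    proof -
      have "y t < y (norm x)"
        by (rule DERIV_neg_imp_decreasing[OF that])
           (use dy neg x(1) in \<open>metis less_le_trans zero_less_norm_iff\<close>)
      with yx b show ?thesis by simp
    qed
    then show "\<forall>\<^sub>F t in at_top. y t < b"
      by (intro eventually_mono[OF eventually_gt_at_top[of "norm x"]])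
  qed
  have "decaying_solution (\<lambda>t. real (CARD('n) - 1) * (cosh t / sinh t)) (\<lambda>t. real (CARD('n) - 1) / (sinh t)\<^sup>2) y"
    unfolding decaying_solution_def using dy dy' ode lim by blast
  then show ?thesis
    by (rule that[OF A y])
qed

section \<open>Existence: the explicit profile and its inverse\<close>

lemma ex_reversing_rotsym_harmonic_diffeo:
  assumes "CARD('n::finite) \<ge> 2"
  shows "\<exists>u :: real^'n \<Rightarrow> real^'n. reversing_rotsym_harmonic_diffeo u"
proof -
  define m where "m = real (CARD('n) - 1)"
  have m: "m > 0" using assms by (simp add: m_def)
  define y where "y = (\<lambda>t. sinh t powr (- m))"
  \<comment> \<open>Solving t = sinh(r)^(-m) for r gives the inverse profile \<open>s\<close>, hence
    the inverse map \<open>v\<close>.\<close>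
  define s where "s = (\<lambda>t. arsinh (t powr (- 1 / m)))"
  have sinh_pos: "sinh t > 0" if "t > 0" for t :: real using that by simp
  have y_pos: "y t > 0" if "t > 0" for t
    using sinh_pos[OF that] by (simp add: y_def)
  have s_pos: "s t > 0" if "t > 0" for t
    using that by (simp add: s_def)
  have sy: "s (y t) = t" if "t > 0" for t
    using sinh_pos[OF that] m by (simp add: s_def y_def powr_powr arsinh_sinh_real)
  have ys: "y (s t) = t" if "t > 0" for t
    using that m by (simp add: s_def y_def powr_powr)
  define u :: "real^'n \<Rightarrow> real^'n" where "u = (\<lambda>x. y (norm x) *\<^sub>R sgn x)"
  define v :: "real^'n \<Rightarrow> real^'n" where "v = (\<lambda>x. s (norm x) *\<^sub>R sgn x)"
  have nsgn: "norm (g *\<^sub>R sgn x) = g" "sgn (g *\<^sub>R sgn x) = sgn x"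
    if "g > 0" "x \<in> punctured" for g and x :: "real^'n"
    using that by (auto simp: punctured_def norm_sgn sgn_scaleR sgn_div_norm field_simps)
  have norm_sgn_eq: "norm x *\<^sub>R sgn x = x" for x :: "real^'n"
    by (cases "x = 0") (simp_all add: sgn_div_norm)
  have u_punct: "u x \<in> punctured" and vu: "v (u x) = x" if "x \<in> punctured" for x
  proof -
    have "norm x > 0" using that by (simp add: punctured_def)
    note * = nsgn[OF y_pos[OF this] that] sy[OF this]
    show "v (u x) = x"
      unfolding u_def v_def * by (rule norm_sgn_eq)
    show "u x \<in> punctured"
      using *(1) y_pos[OF \<open>norm x > 0\<close>] by (auto simp: u_def punctured_def)
  qed
  have v_punct: "v x \<in> punctured" and uv: "u (v x) = x" if "x \<in> punctured" for x
  proof -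
    have "norm x > 0" using that by (simp add: punctured_def)
    note * = nsgn[OF s_pos[OF this] that] ys[OF this]
    show "u (v x) = x"
      unfolding u_def v_def * by (rule norm_sgn_eq)
    show "v x \<in> punctured"
      using *(1) s_pos[OF \<open>norm x > 0\<close>] by (auto simp: v_def punctured_def)
  qed
  have bij: "bij_betw u punctured punctured"
    by (rule bij_betw_byWitness[where f' = v]) (use u_punct vu v_punct uv in auto)
  have inv: "inv_into punctured u x = v x" if "x \<in> punctured" for x
    using that bij uv v_punct by (intro inv_into_f_eq) (auto simp: bij_betw_def)
  \<comment> \<open>Agreement is required only on \<open>punctured\<close>, so that this also
    applies to \<open>inv_into punctured u\<close>, which is known to equal \<open>v\<close> only
    there.\<close>
  have radial: "smooth_on punctured g"
    if g: "\<And>x. x \<in> punctured \<Longrightarrow> g x = h (norm x) *\<^sub>R sgn x" and h: "\<And>k. Ck_on k {0<..} h"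
    for g :: "real^'n \<Rightarrow> real^'n" and h
  proof -
    have "smooth_on punctured (\<lambda>x::real^'n. (h (norm x) * norm x powr (- 1)) *\<^sub>R x)"
      by (rule smooth_on_radial) (intro Ck_on_mult h Ck_on_powr, simp)
    then show ?thesis
      unfolding smooth_on_def
      by - (rule allI, rule Ck_on_cong[OF open_punctured, of "\<lambda>x. (h (norm x) * norm x powr (- 1)) *\<^sub>R x"],
        simp_all add: g sgn_div_norm powr_minus punctured_def)
  qed
  have smooth_y: "Ck_on k {0<..} y" for k
    unfolding y_def
    by (rule Ck_on_compose_real[OF _ _ Ck_on_powr]) (auto intro: Ck_on_sinh)
  have smooth_s: "Ck_on k {0<..} s" for k
    unfolding s_def
    by (rule Ck_on_compose_real[OF _ _ Ck_on_arsinh Ck_on_powr]) auto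
  have diffeo: "diffeomorphism_onto punctured punctured u"
    unfolding diffeomorphism_onto_def
    using bij radial[of u y] radial[of "inv_into punctured u" s] smooth_y smooth_s inv
    by (auto simp: u_def v_def)
  have dy: "(y has_real_derivative - m * (y t * cosh t / sinh t)) (at t)" if "t > 0" for t
    using sinh_pos[OF that] unfolding y_def
    by (auto intro!: derivative_eq_intros simp: powr_diff powr_minus field_simps)
  have ux: "u x = y (norm x) *\<^sub>R (mat 1 *v sgn x)" for x
    by (simp add: u_def)
  have "orientation_reversing_on punctured u"
    unfolding orientation_reversing_on_def
  proof
    fix x :: "real^'n" assume "x \<in> punctured"
    then have x: "x \<noteq> 0" by (simp add: punctured_def)
    have "y (norm x) > 0" "sinh (norm x) > 0"
      using x by (auto intro: y_pos)
    then show "det (jacobian u (at x)) < 0"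
      using x m by (subst det_jacobian_radial[OF ux dy]) (auto simp: mult_less_0_iff)
  qed
  moreover have "rotationally_symmetric u"
    unfolding rotationally_symmetric_def
    by (intro exI[of _ y] exI[of _ "mat 1"])
       (auto simp: u_def y_pos rotation_matrix_def orthogonal_matrix_id)
  moreover have "harmonic_map_on punctured hyperbolic_metric flat_metric u"
    unfolding harmonic_map_on_def hyperbolic_metric_def
  proof (intro conjI ballI)
    show "smooth_on punctured u"
      using diffeo by (simp add: diffeomorphism_onto_def)
    fix x :: "real^'n" assume "x \<in> punctured"
    then have x: "x \<noteq> 0" "u x \<noteq> 0" using u_punct by (auto simp: punctured_def)
    define t where "t = norm x"
    have t: "t > 0" using x by (simp add: t_def)
    have c: "(cosh t)\<^sup>2 - (sinh t)\<^sup>2 = 1"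
      by (simp add: cosh_square_eq)
    \<comment> \<open>The factor cosh^2 - sinh^2 is kept so that differentiation is purely
      algebraic. Replacing it by 1 later makes the second term cancel the zeroth-order term of the
      equation, while the first cancels the first-order term.\<close>
    define y'' where "y'' = m\<^sup>2 * y t * (cosh t)\<^sup>2 / (sinh t)\<^sup>2 + m * y t * ((cosh t)\<^sup>2 - (sinh t)\<^sup>2) / (sinh t)\<^sup>2"
    have dy': "((\<lambda>t. - m * (y t * cosh t / sinh t)) has_real_derivative y'') (at t)"
      using sinh_pos[OF t] unfolding y''_def
      by (auto intro!: derivative_eq_intros dy[OF t] simp: field_simps power2_eq_square)
    have "tension (polar_metric sinh) flat_metric u x =
      (y'' + m * (cosh t / sinh (norm x)) * (- m * (y (norm x) * cosh (norm x) / sinh (norm x)))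
        - m * y (norm x) / (sinh (norm x))\<^sup>2) *\<^sub>R (mat 1 *v sgn x)"
      unfolding m_def
      by (rule tension_radial[OF ux dy[unfolded m_def]])
         (use x t dy' in \<open>auto intro!: derivative_eq_intros simp: t_def m_def\<close>)
    also have "\<dots> = 0"
      using sinh_pos[OF t] by (simp add: y''_def c flip: t_def) (simp add: field_simps power2_eq_square)
    finally show "tension (polar_metric sinh) flat_metric u x = 0" .
  qed
  ultimately show ?thesis
    using diffeo unfolding reversing_rotsym_harmonic_diffeo_def by blast
qed

section \<open>Existence together with the comparison of two maps\<close>

theorem theorem1p1:
  assumes "CARD('n::finite) \<ge> 2"
  shows "(\<exists>u :: real^'n \<Rightarrow> real^'n. reversing_rotsym_harmonic_diffeo u) \<and>
    (\<forall>u\<^sub>1 u\<^sub>2 :: real^'n \<Rightarrow> real^'n.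
       reversing_rotsym_harmonic_diffeo u\<^sub>1 \<and> reversing_rotsym_harmonic_diffeo u\<^sub>2 \<longrightarrow>
       (\<exists>(c::real) A. c > 0 \<and> rotation_matrix A \<and>
          (\<forall>x\<in>punctured. u\<^sub>2 x = c *\<^sub>R (A *v u\<^sub>1 x))))"
proof (intro conjI allI impI)
  show "\<exists>u :: real^'n \<Rightarrow> real^'n. reversing_rotsym_harmonic_diffeo u"
    using assms by (rule ex_reversing_rotsym_harmonic_diffeo)
next
  fix u\<^sub>1 u\<^sub>2 :: "real^'n \<Rightarrow> real^'n"
  assume u: "reversing_rotsym_harmonic_diffeo u\<^sub>1 \<and> reversing_rotsym_harmonic_diffeo u\<^sub>2"
  obtain y\<^sub>1 A\<^sub>1 where 1: "rotation_matrix A\<^sub>1" "\<forall>t>0. y\<^sub>1 t > 0"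
    "\<forall>x\<in>punctured. u\<^sub>1 x = y\<^sub>1 (norm x) *\<^sub>R (A\<^sub>1 *v sgn x)"
    "decaying_solution (\<lambda>t. real (CARD('n) - 1) * (cosh t / sinh t)) (\<lambda>t. real (CARD('n) - 1) / (sinh t)\<^sup>2) y\<^sub>1"
    by (rule profile_of_reversing_rotsym_harmonic_diffeo[OF conjunct1[OF u]])
  obtain y\<^sub>2 A\<^sub>2 where 2: "rotation_matrix A\<^sub>2" "\<forall>t>0. y\<^sub>2 t > 0"
    "\<forall>x\<in>punctured. u\<^sub>2 x = y\<^sub>2 (norm x) *\<^sub>R (A\<^sub>2 *v sgn x)"
    "decaying_solution (\<lambda>t. real (CARD('n) - 1) * (cosh t / sinh t)) (\<lambda>t. real (CARD('n) - 1) / (sinh t)\<^sup>2) y\<^sub>2"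
    by (rule profile_of_reversing_rotsym_harmonic_diffeo[OF conjunct2[OF u]])
  have q: "real (CARD('n) - 1) / (sinh t)\<^sup>2 > 0" if "t > 0" for t
    using assms that by simp
  \<comment> \<open>The two profiles are proportional, so their ratio may be read off at radius 1.
    Orthogonality of \<open>A\<^sub>1\<close> makes
    \<open>A ** A\<^sub>1 = A\<^sub>2\<close>.\<close>
  define c where "c = y\<^sub>2 1 / y\<^sub>1 1"
  define A where "A = A\<^sub>2 ** transpose A\<^sub>1"
  have c: "y\<^sub>2 t = c * y\<^sub>1 t" if "t > 0" for t
    using decaying_solution_unique[OF 1(4) 2(4) q, of 1 t] 1(2)[rule_format, of 1] that
    by (simp add: c_def field_simps)
  have "c > 0"
    using 1(2) 2(2) by (simp add: c_def)
  moreover have "rotation_matrix A"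
    using 1(1) 2(1)
    by (simp add: A_def rotation_matrix_def orthogonal_matrix_mul orthogonal_matrix_transpose det_mul)
  moreover have "u\<^sub>2 x = c *\<^sub>R (A *v u\<^sub>1 x)" if "x \<in> punctured" for x
  proof -
    have x: "x \<noteq> 0" using that by (simp add: punctured_def)
    have "A *v (A\<^sub>1 *v sgn x) = A\<^sub>2 *v sgn x"
      using 1(1) by (simp add: A_def matrix_vector_mul_assoc rotation_matrix_def orthogonal_matrix_def
          flip: matrix_mul_assoc)
    then show ?thesis
      using x that by (simp add: 1(3) 2(3) c matrix_vector_mult_scaleR)
  qed
  ultimately show "\<exists>c A. c > 0 \<and> rotation_matrix A \<and> (\<forall>x\<in>punctured. u\<^sub>2 x = c *\<^sub>R (A *v u\<^sub>1 x))"
    by blast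
qed

end
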